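(* Let $G$ be a finite simple graph with vertices $v_1,\dots,v_n$, edges $e_1,\dots,e_m$ and maximum degree $\Delta$, and let $p\geq m^2(2\Delta+2)$ be a prime. Let $$\mathbf{P}(v_1,\dots,v_n,e_1,\dots,e_m)=\prod_{i=1}^{n}\Bigg(\prod_{v_j\in N_i(v_i)}(v_i-v_j)\prod_{e_j\in N_e(v_i)}(v_i-e_j)\prod_{l=\Delta+2}^{p}(v_i-l)\Bigg)\in\mathbb{Z}_p[v_1,\dots,v_n,e_1,\dots,e_m]$$ with reduction $\mathbf{P}'$. Then there exist $\alpha\in\mathbb{Z}_p\setminus\{0,1,\dots,\Delta+1\}$, $\beta_{e_1},\dots,\beta_{e_m}\in\{1,2,\dots,\Delta+1,\alpha\}$ and a monomial $\prod_{j=1}^n v_j^{l_j}$ whose coefficient $\mathcal{C}^{\mathbf{P}'}(e_1,\dots,e_m)$ in $\mathbf{P}'$ satisfies $\mathcal{C}^{\mathbf{P}'}(\beta_{e_1},\dots,\beta_{e_m})\not\equiv 0 \pmod p$, and there exist $\beta_{v_1},\dots,\beta_{v_n}\in\{1,2,\dots,\Delta+1\}$ such that $\mathbf{P}'(\beta_{v_1},\dots,\beta_{v_n},\beta_{e_1},\dots,\beta_{e_m})\not\equiv 0\pmod p$.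
   Context: $N(v_i)$ is the neighbourhood of $v_i$; $N_1(v_1)=N(v_1)$ and $N_i(v_i)=N(v_i)\setminus\{v_1,\dots,v_{i-1}\}$ for $i\ge 2$; $N_e(v_i)$ is the set of edges incident to $v_i$; empty products equal $1$; integers are taken mod $p$. The reduction $F'$ of a polynomial $F$ over $\mathbb{Z}_p$ is obtained by repeatedly replacing $x^p$ by $x$ for each variable $x$. The coefficient of $\prod_j v_j^{l_j}$ in $\mathbf{P}'$ is taken viewing $\mathbf{P}'$ as a polynomial in $v_1,\dots,v_n$ with coefficients in $\mathbb{Z}_p[e_1,\dots,e_m]$.
   Formalization: The case of a graph with no edges (m = 0) and p = 2 is excluded: there Δ = 0 and the bound on p holds, but Z_2 without {0,1} is empty, so no α exists and the claim fails. *)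

theory Defs
  imports "HOL-Library.Poly_Mapping" "Berlekamp_Zassenhaus.Finite_Field"
begin

text \<open>Finite simple graphs; an edge is the set of its two ends.\<close>

definition simple_graph :: "'a set \<Rightarrow> 'a set set \<Rightarrow> bool" where
  "simple_graph V E \<longleftrightarrow> finite V \<and> (\<forall>f\<in>E. f \<subseteq> V \<and> card f = 2)"

definition nbhd :: "'a set set \<Rightarrow> 'a \<Rightarrow> 'a set" where
  "nbhd E x = {y. {x, y} \<in> E}"

definition incident_edges :: "'a set set \<Rightarrow> 'a \<Rightarrow> 'a set set" where
  "incident_edges E x = {f \<in> E. x \<in> f}"

text \<open>The inserted \<open>0\<close> only matters for the graph without vertices.\<close>

definition max_degree :: "'a set \<Rightarrow> 'a set set \<Rightarrow> nat" where
  "max_degree V E = Max (insert 0 ((\<lambda>x. card (nbhd E x)) ` V))"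

definition later_nbhd :: "'a set set \<Rightarrow> (nat \<Rightarrow> 'a) \<Rightarrow> nat \<Rightarrow> 'a set" where
  "later_nbhd E v i = nbhd E (v i) - v ` {1..<i}"

text \<open>
  A multivariate polynomial maps exponent vectors to coefficients, both with finite support;
  the ring structure is the convolution product of \<^theory>\<open>HOL-Library.Poly_Mapping\<close>.
\<close>

type_synonym ('x, 'c) mpol = "('x \<Rightarrow>\<^sub>0 nat) \<Rightarrow>\<^sub>0 'c"

definition Var :: "'x \<Rightarrow> ('x, 'c::comm_ring_1) mpol" where
  "Var x = Poly_Mapping.single (Poly_Mapping.single x 1) 1"

definition eval_mpol :: "('x \<Rightarrow> 'c::comm_ring_1) \<Rightarrow> ('x, 'c) mpol \<Rightarrow> 'c" where
  "eval_mpol b F =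
     (\<Sum>k\<in>Poly_Mapping.keys F.
        Poly_Mapping.lookup F k * (\<Prod>x\<in>Poly_Mapping.keys k. b x ^ Poly_Mapping.lookup k x))"

text \<open>
  Replacing \<open>x ^ p\<close> by \<open>x\<close> turns an exponent \<open>k \<ge> p\<close> into \<open>k - p + 1\<close>; this is repeated
  as long as possible. The test \<open>p < 2\<close> is there for termination only.
\<close>

fun red_exp :: "nat \<Rightarrow> nat \<Rightarrow> nat" where
  "red_exp p k = (if p < 2 \<or> k < p then k else red_exp p (k - p + 1))"

declare red_exp.simps [simp del]

definition reduction :: "('x, 'p::prime_card mod_ring) mpol \<Rightarrow> ('x, 'p mod_ring) mpol" where
  "reduction F =
     (\<Sum>k\<in>Poly_Mapping.keys F.
        Poly_Mapping.single (Poly_Mapping.map (red_exp CARD('p)) k) (Poly_Mapping.lookup F k))"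

datatype 'a gvar = VVar 'a | EVar "'a set"

text \<open>
  The coefficient, itself a polynomial in the edge variables, of the monomial in the vertex
  variables with exponent vector \<open>l\<close>. Composing an exponent vector with \<open>VVar\<close> or \<open>EVar\<close>
  (\<open>map_key\<close>) extracts its vertex part or its edge part.
\<close>

definition vertex_coeff ::
  "('a gvar, 'c::comm_ring_1) mpol \<Rightarrow> ('a \<Rightarrow>\<^sub>0 nat) \<Rightarrow> ('a set, 'c) mpol" where
  "vertex_coeff F l =
     (\<Sum>k\<in>{k \<in> Poly_Mapping.keys F. Poly_Mapping.map_key VVar k = l}.
        Poly_Mapping.single (Poly_Mapping.map_key EVar k) (Poly_Mapping.lookup F k))"

definition total_poly ::
  "'a set \<Rightarrow> 'a set set \<Rightarrow> (nat \<Rightarrow> 'a) \<Rightarrow> ('a gvar, 'p::prime_card mod_ring) mpol" where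
  "total_poly V E v =
     (\<Prod>i = 1..card V.
        (\<Prod>w\<in>later_nbhd E v i. Var (VVar (v i)) - Var (VVar w)) *
        (\<Prod>f\<in>incident_edges E (v i). Var (VVar (v i)) - Var (EVar f)) *
        (\<Prod>l = max_degree V E + 2..CARD('p). Var (VVar (v i)) - of_nat l))"

end

theory Submission
  imports Defs
begin

text \<open>
  By Fermat's little theorem \<open>P'\<close> and \<open>P\<close> agree as functions. The factors of \<open>P\<close> separate the
  ends of every edge and each edge from its ends, but not two edges from each other. Hence all
  edges may take the same value \<open>\<alpha> = \<Delta> + 2\<close>, and a greedy proper colouring of the vertices makes
  \<open>P\<close> nonzero. If some value of \<open>P'\<close> is nonzero, then so is some vertex coefficient. The colouring
  is extended by \<open>0\<close> outside \<open>V\<close>, so that only monomials in the vertices of \<open>G\<close> contribute.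
\<close>

section \<open>Evaluation as a ring homomorphism\<close>

definition eval_monom :: "('x \<Rightarrow> 'c::comm_ring_1) \<Rightarrow> ('x \<Rightarrow>\<^sub>0 nat) \<Rightarrow> 'c" where
  "eval_monom b k = (\<Prod>x\<in>Poly_Mapping.keys k. b x ^ Poly_Mapping.lookup k x)"

text \<open>Variables outside the keys have exponent 0 and contribute a factor 1. Monomials with
  different keys can thus be compared over one index set.\<close>

lemma eval_monom_superset:
  assumes "finite A" "Poly_Mapping.keys k \<subseteq> A"
  shows "eval_monom b k = (\<Prod>x\<in>A. b x ^ Poly_Mapping.lookup k x)"
  unfolding eval_monom_def
  by (rule prod.mono_neutral_left) (use assms in \<open>auto simp: in_keys_iff\<close>)

lemma eval_monom_0 [simp]: "eval_monom b 0 = 1"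
  by (simp add: eval_monom_def)

lemma eval_monom_single [simp]: "eval_monom b (Poly_Mapping.single x n) = b x ^ n"
  by (simp add: eval_monom_def)

lemma eval_monom_add: "eval_monom b (k + k') = eval_monom b k * eval_monom b k'"
proof -
  let ?A = "Poly_Mapping.keys k \<union> Poly_Mapping.keys k'"
  have "Poly_Mapping.keys (k + k') \<subseteq> ?A"
    by (rule Poly_Mapping.keys_add)
  then show ?thesis
    by (simp add: eval_monom_superset[of ?A] lookup_add power_add prod.distrib)
qed

lemma eval_mpol_alt:
  "eval_mpol b F = (\<Sum>k\<in>Poly_Mapping.keys F. Poly_Mapping.lookup F k * eval_monom b k)"
  by (simp add: eval_mpol_def eval_monom_def)

lemma eval_mpol_0 [simp]: "eval_mpol b 0 = 0"
  by (simp add: eval_mpol_alt)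

lemma eval_mpol_single [simp]: "eval_mpol b (Poly_Mapping.single k c) = c * eval_monom b k"
  by (simp add: eval_mpol_alt)

lemma eval_mpol_add: "eval_mpol b (F + G) = eval_mpol b F + eval_mpol b G"
  unfolding eval_mpol_alt
  by (rule setsum_keys_plus_distrib) (simp_all add: algebra_simps)

lemma eval_mpol_diff: "eval_mpol b (F - G) = eval_mpol b F - eval_mpol b G"
  using eval_mpol_add[of b "F - G" G] by simp

lemma eval_mpol_sum: "eval_mpol b (sum F A) = (\<Sum>a\<in>A. eval_mpol b (F a))"
  by (induction A rule: infinite_finite_induct) (simp_all add: eval_mpol_add)

lemma sum_single_lookup:
  "(\<Sum>k\<in>Poly_Mapping.keys F. Poly_Mapping.single k (Poly_Mapping.lookup F k)) = F"
proof (rule poly_mapping_eqI)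
  fix k
  show "Poly_Mapping.lookup
      (\<Sum>k\<in>Poly_Mapping.keys F. Poly_Mapping.single k (Poly_Mapping.lookup F k)) k =
    Poly_Mapping.lookup F k"
    by (simp add: lookup_sum lookup_single when_def in_keys_iff)
qed

text \<open>Writing both factors as sums of single terms reduces the claim to
  \<open>eval_monom_add\<close>.\<close>

lemma eval_mpol_mult: "eval_mpol b (F * G) = eval_mpol b F * eval_mpol b G"
proof -
  let ?s = "\<lambda>H k. Poly_Mapping.single k (Poly_Mapping.lookup H k)"
  have "F * G = (\<Sum>k\<in>Poly_Mapping.keys F. ?s F k) * (\<Sum>k\<in>Poly_Mapping.keys G. ?s G k)"
    by (simp add: sum_single_lookup)
  also have "eval_mpol b \<dots> = eval_mpol b F * eval_mpol b G"
    by (simp add: sum_product mult_single eval_mpol_sum eval_monom_add)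
      (simp add: eval_mpol_alt sum_product mult_ac)
  finally show ?thesis .
qed

lemma eval_mpol_1 [simp]: "eval_mpol b 1 = 1"
  by (simp flip: single_one)

lemma eval_mpol_of_nat [simp]: "eval_mpol b (of_nat n) = of_nat n"
  by (simp flip: single_of_nat)

lemma eval_mpol_Var [simp]: "eval_mpol b (Var x) = b x"
  by (simp add: Var_def)

lemma eval_mpol_prod: "eval_mpol b (prod F A) = (\<Prod>a\<in>A. eval_mpol b (F a))"
  by (induction A rule: infinite_finite_induct) (simp_all add: eval_mpol_mult)

section \<open>Fermat's little theorem and reduced exponents\<close>

text \<open>The inverse of a nonzero \<open>a\<close> is defined in \<open>mod_ring\<close> as its
  power with exponent \<open>CARD('p) - 2\<close>, so the claim follows from
  \<open>left_inverse\<close>.\<close>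

lemma mod_ring_power_card: "a ^ CARD('p) = (a :: 'p::prime_card mod_ring)"
proof (cases "a = 0")
  case False
  have p: "CARD('p) \<ge> 2"
    using prime_card prime_ge_2_nat by blast
  then have "a ^ (CARD('p) - 2) * a = 1"
    using False left_inverse[OF False] by (simp add: inverse_mod_ring_def nat_diff_distrib)
  then have "a ^ (CARD('p) - 2) * a * a = a"
    by simp
  moreover have "a ^ CARD('p) = a ^ (CARD('p) - 2) * a * a"
    using power_add[of a "CARD('p) - 2" 2] le_add_diff_inverse2[OF p]
    by (simp only: power2_eq_square mult.assoc)
  ultimately show ?thesis by simp
qed (simp add: zero_power)

text \<open>Each step of \<open>red_exp\<close> trades a factor \<open>a ^ CARD('p)\<close> for
  \<open>a\<close>, which \<open>mod_ring_power_card\<close> permits.\<close>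

lemma power_red_exp: "a ^ red_exp CARD('p) k = (a :: 'p::prime_card mod_ring) ^ k"
proof (induction "CARD('p)" k rule: red_exp.induct)
  case (1 k)
  show ?case
  proof (cases "CARD('p) < 2 \<or> k < CARD('p)")
    case True
    then show ?thesis by (simp add: red_exp.simps)
  next
    case False
    then have "a ^ red_exp CARD('p) k = a ^ (k - CARD('p)) * a"
      using 1 by (simp add: red_exp.simps[of _ k])
    also have "\<dots> = a ^ (k - CARD('p)) * a ^ CARD('p)"
      by (simp add: mod_ring_power_card)
    also have "\<dots> = a ^ k"
      using False by (simp flip: power_add)
    finally show ?thesis .
  qed
qed

lemma eval_monom_red_exp:
  fixes b :: "'x \<Rightarrow> 'p::prime_card mod_ring"
  shows "eval_monom b (Poly_Mapping.map (red_exp CARD('p)) k) = eval_monom b k"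
proof -
  \<comment> \<open>\<open>Poly_Mapping.map\<close> leaves the exponent 0 alone, so no new variable
    appears.\<close>
  have "Poly_Mapping.keys (Poly_Mapping.map (red_exp CARD('p)) k) \<subseteq> Poly_Mapping.keys k"
    by (auto simp: in_keys_iff map.rep_eq when_def split: if_splits)
  then show ?thesis
    by (simp add: eval_monom_superset[of "Poly_Mapping.keys k"])
      (simp add: map.rep_eq power_red_exp in_keys_iff)
qed

lemma eval_mpol_reduction: "eval_mpol b (reduction F) = eval_mpol b F"
  by (simp add: reduction_def eval_mpol_sum eval_monom_red_exp)
    (simp add: eval_mpol_alt)

section \<open>Vertex part and edge part of a polynomial\<close>

text \<open>The keys split into disjoint images of the injective constructors \<open>VVar\<close>
  and \<open>EVar\<close>; each part of the product is reindexed by its constructor.\<close>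

lemma eval_monom_gvar:
  "eval_monom (case_gvar bv be) k =
     eval_monom bv (Poly_Mapping.map_key VVar k) * eval_monom be (Poly_Mapping.map_key EVar k)"
proof -
  let ?X = "VVar -` Poly_Mapping.keys k" and ?Y = "EVar -` Poly_Mapping.keys k"
  have inj: "inj VVar" "inj EVar"
    by (auto intro: injI)
  have keys: "Poly_Mapping.keys k = VVar ` ?X \<union> EVar ` ?Y"
  proof -
    have "g \<in> VVar ` ?X \<union> EVar ` ?Y" if "g \<in> Poly_Mapping.keys k" for g
      using that by (cases g) auto
    then show ?thesis by auto
  qed
  have fin: "finite ?X" "finite ?Y"
    by (auto intro!: finite_vimageI inj)
  have "eval_monom (case_gvar bv be) k =
      (\<Prod>g\<in>VVar ` ?X \<union> EVar ` ?Y. case_gvar bv be g ^ Poly_Mapping.lookup k g)"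
    using keys by (simp add: eval_monom_def)
  also have "\<dots> =
      (\<Prod>g\<in>VVar ` ?X. case_gvar bv be g ^ Poly_Mapping.lookup k g) *
      (\<Prod>g\<in>EVar ` ?Y. case_gvar bv be g ^ Poly_Mapping.lookup k g)"
    by (rule prod.union_disjoint) (use fin in auto)
  also have "\<dots> =
      (\<Prod>x\<in>?X. bv x ^ Poly_Mapping.lookup k (VVar x)) *
      (\<Prod>f\<in>?Y. be f ^ Poly_Mapping.lookup k (EVar f))"
    using inj by (subst (1 2) prod.reindex) (auto simp: inj_on_def)
  finally show ?thesis
    by (simp add: eval_monom_def keys_map_key map_key.rep_eq inj)
qed

text \<open>The terms of \<open>F\<close> are grouped by their vertex part \<open>l\<close>, and the
  common factor \<open>eval_monom bv l\<close> is taken out of each group.\<close>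

lemma eval_mpol_vertex_coeff:
  "eval_mpol (case_gvar bv be) F =
     (\<Sum>l\<in>Poly_Mapping.map_key VVar ` Poly_Mapping.keys F.
        eval_monom bv l * eval_mpol be (vertex_coeff F l))"
proof -
  let ?t = "\<lambda>k. Poly_Mapping.lookup F k * eval_monom (case_gvar bv be) k"
  have "eval_mpol (case_gvar bv be) F =
      (\<Sum>l\<in>Poly_Mapping.map_key VVar ` Poly_Mapping.keys F.
        \<Sum>k\<in>{k \<in> Poly_Mapping.keys F. Poly_Mapping.map_key VVar k = l}. ?t k)"
    unfolding eval_mpol_alt by (rule sum.image_gen) simp
  also have "\<dots> = (\<Sum>l\<in>Poly_Mapping.map_key VVar ` Poly_Mapping.keys F.
        eval_monom bv l * eval_mpol be (vertex_coeff F l))"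
    by (intro sum.cong refl)
      (auto simp: vertex_coeff_def eval_mpol_sum sum_distrib_left eval_monom_gvar mult_ac
        intro!: sum.cong)
  finally show ?thesis .
qed

text \<open>A nonzero sum has a nonzero summand. Its vertex monomial contains no variable outside
  \<open>V\<close>, since \<open>bv\<close> would make it vanish.\<close>

lemma nonzero_vertex_coeff:
  fixes F :: "('a gvar, 'c::idom) mpol"
  assumes "eval_mpol (case_gvar bv be) F \<noteq> 0" "\<And>x. x \<notin> V \<Longrightarrow> bv x = 0"
  obtains l where "Poly_Mapping.keys l \<subseteq> V" "eval_mpol be (vertex_coeff F l) \<noteq> 0"
proof -
  obtain l where "eval_monom bv l * eval_mpol be (vertex_coeff F l) \<noteq> 0"
    using assms(1) unfolding eval_mpol_vertex_coeff by (meson sum.neutral)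
  then have l: "eval_monom bv l \<noteq> 0" "eval_mpol be (vertex_coeff F l) \<noteq> 0"
    by auto
  have "Poly_Mapping.keys l \<subseteq> V"
  proof
    fix x assume "x \<in> Poly_Mapping.keys l"
    with l(1) have "bv x ^ Poly_Mapping.lookup l x \<noteq> 0" "Poly_Mapping.lookup l x \<noteq> 0"
      by (auto simp: eval_monom_def in_keys_iff)
    then show "x \<in> V"
      using assms(2)[of x] by (auto simp: zero_power)
  qed
  with l(2) show ?thesis by (rule that[rotated])
qed

text \<open>The theorem gives monomials by exponents along the enumeration \<open>v\<close>; this
  brings an exponent vector supported in \<open>V\<close> into that form.\<close>

lemma sum_single_reindex:
  assumes "bij_betw v I V" "finite I" "Poly_Mapping.keys l \<subseteq> V"
  shows "(\<Sum>j\<in>I. Poly_Mapping.single (v j) (Poly_Mapping.lookup l (v j))) = l"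
proof -
  have fin: "finite V"
    using assms(1,2) bij_betw_finite by blast
  have "(\<Sum>j\<in>I. Poly_Mapping.single (v j) (Poly_Mapping.lookup l (v j))) =
      (\<Sum>x\<in>V. Poly_Mapping.single x (Poly_Mapping.lookup l x))"
    by (rule sum.reindex_bij_betw[OF assms(1)])
  also have "\<dots> = (\<Sum>x\<in>Poly_Mapping.keys l. Poly_Mapping.single x (Poly_Mapping.lookup l x))"
    by (rule sum.mono_neutral_right) (use assms(3) fin in \<open>auto simp: in_keys_iff\<close>)
  finally show ?thesis by (simp add: sum_single_lookup)
qed

text \<open>The numbers from 1 to \<open>CARD('p)\<close> represent each residue once, the last one
  standing for 0. This range contains the colours as well as the roots \<open>l\<close> in
  \<open>total_poly\<close>.\<close>

lemma of_nat_mod_ring_inj: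
  assumes "of_nat x = (of_nat y :: 'p::prime_card mod_ring)" "0 < x" "x \<le> CARD('p)" "0 < y" "y \<le> CARD('p)"
  shows "x = y"
proof -
  have aux: "x = y" if "of_nat x = (of_nat y :: 'p mod_ring)" "y \<le> x" "x \<le> CARD('p)" "0 < y"
    for x y :: nat
  proof -
    have "of_nat (x - y) = (0 :: 'p mod_ring)"
      using that by (simp add: of_nat_diff)
    then have "CARD('p) dvd x - y"
      by (rule of_nat_0_mod_ring_dvd)
    then show ?thesis
      using that by (auto dest: dvd_imp_le)
  qed
  show ?thesis
    using aux[of x y] aux[of y x] assms by (cases "y \<le> x") auto
qed

section \<open>Greedy colouring and bounds on the maximum degree\<close>

context
  fixes V :: "'a set" and E :: "'a set set"
  assumes graph: "simple_graph V E"
begin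

lemma nbhd_subset: "nbhd E x \<subseteq> V"
  using graph by (auto simp: simple_graph_def nbhd_def)

lemma finite_nbhd: "finite (nbhd E x)"
  using finite_subset[OF nbhd_subset] graph by (auto simp: simple_graph_def)

lemma nbhd_irrefl: "x \<notin> nbhd E x"
  using graph by (auto simp: simple_graph_def nbhd_def)

lemma card_nbhd_le_max_degree: "x \<in> V \<Longrightarrow> card (nbhd E x) \<le> max_degree V E"
  using graph by (auto simp: simple_graph_def max_degree_def intro!: Max_ge)

text \<open>Induction adds one vertex at a time: it has at most \<Delta> neighbours, so one of the
  \<Delta> + 1 colours is free.\<close>

lemma greedy_colouring:
  "S \<subseteq> V \<Longrightarrow> \<exists>c :: 'a \<Rightarrow> nat. (\<forall>x\<in>S. c x \<in> {1..max_degree V E + 1}) \<and>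
     (\<forall>x\<in>S. \<forall>y\<in>S. y \<in> nbhd E x \<longrightarrow> c x \<noteq> c y)"
proof (induction S rule: infinite_finite_induct)
  case (infinite S)
  then show ?case
    using graph finite_subset by (auto simp: simple_graph_def)
next
  case empty
  then show ?case by simp
next
  case (insert x S)
  then obtain c where c: "\<forall>x\<in>S. c x \<in> {1..max_degree V E + 1}"
      "\<forall>x\<in>S. \<forall>y\<in>S. y \<in> nbhd E x \<longrightarrow> c x \<noteq> c y"
    by auto
  \<comment> \<open>Neighbours outside \<open>S\<close> are counted too, with whatever value
    \<open>c\<close> has there; the degree bound covers them all.\<close>
  have "card (c ` nbhd E x) \<le> max_degree V E"
    using card_image_le[OF finite_nbhd] card_nbhd_le_max_degree[of x] insert.prems
    by (meson insert_subset le_trans)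
  then have "\<not> {1..max_degree V E + 1} \<subseteq> c ` nbhd E x"
    using card_mono[of "c ` nbhd E x" "{1..max_degree V E + 1}"] finite_nbhd by auto
  then obtain a where a: "a \<in> {1..max_degree V E + 1}" "a \<notin> c ` nbhd E x"
    by blast
  have "c y \<noteq> a" if "y \<in> nbhd E x \<or> x \<in> nbhd E y" for y
    using a(2) that by (auto simp: nbhd_def insert_commute)
  then show ?case
    using insert.hyps(2) c a(1) nbhd_irrefl[of x]
    by (intro exI[of _ "c(x := a)"]) auto
qed

text \<open>Different neighbours of a vertex lie on different edges; conversely, an end of an edge
  has a neighbour.\<close>

lemma card_edges_bounds:
  shows "max_degree V E \<le> card E" "0 < card E \<Longrightarrow> 0 < max_degree V E"
proof -
  have "finite V" "E \<subseteq> Pow V"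
    using graph by (auto simp: simple_graph_def)
  then have fin: "finite E"
    using finite_subset by blast
  have "card (nbhd E x) \<le> card E" for x
    by (rule card_inj_on_le[of "\<lambda>y. {x, y}"]) (auto simp: fin nbhd_def inj_on_def doubleton_eq_iff)
  then show "max_degree V E \<le> card E"
    using \<open>finite V\<close> by (auto simp: max_degree_def)
  assume "0 < card E"
  then obtain f where "f \<in> E"
    by (metis all_not_in_conv card.empty less_irrefl)
  then obtain x y where "f = {x, y}" "x \<in> V"
    using graph by (auto simp: simple_graph_def card_2_iff)
  with \<open>f \<in> E\<close> have "0 < card (nbhd E x)"
    using finite_nbhd by (auto simp: card_gt_0_iff nbhd_def)
  then show "0 < max_degree V E"
    using card_nbhd_le_max_degree[OF \<open>x \<in> V\<close>] by simp
qed

text \<open>Strictness keeps \<Delta> + 2 from being 0 mod \<open>p\<close>. With an edge, \<Delta>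
  is positive and \<open>p\<close> is at least 2\<Delta> + 2; without edges \<Delta> = 0 and
  \<open>p\<close> is at least 3. In the excluded case the residues 0 and 1 are all of them, leaving
  no \<alpha>.\<close>

lemma max_degree_less_prime:
  assumes "(card E)\<^sup>2 * (2 * max_degree V E + 2) \<le> p" "prime p" "\<not> (card E = 0 \<and> p = 2)"
  shows "max_degree V E + 2 < p"
proof (cases "card E = 0")
  case True
  then show ?thesis
    using assms(2,3) card_edges_bounds(1) prime_ge_2_nat[of p] by simp
next
  case False
  then have "1 \<le> (card E)\<^sup>2" "0 < max_degree V E"
    using card_edges_bounds(2) by auto
  then have "2 * max_degree V E + 2 \<le> p"
    using assms(1) mult_le_mono1[of 1 "(card E)\<^sup>2" "2 * max_degree V E + 2"] by simp
  then show ?thesis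
    using \<open>0 < max_degree V E\<close> by simp
qed

section \<open>Nonvanishing at the colouring\<close>

text \<open>In a field it suffices that every factor is nonzero, which is a comparison of numbers
  between 1 and \<open>CARD('p)\<close>.\<close>

lemma eval_total_poly_nonzero:
  fixes c :: "'a \<Rightarrow> nat" and b :: "'a \<Rightarrow> 'p::prime_card mod_ring"
  assumes v: "bij_betw v {1..card V} V"
    and p: "max_degree V E + 2 \<le> CARD('p)"
    and c: "\<And>x. x \<in> V \<Longrightarrow> c x \<in> {1..max_degree V E + 1}"
      "\<And>x y. x \<in> V \<Longrightarrow> y \<in> nbhd E x \<Longrightarrow> c x \<noteq> c y"
    and b: "\<And>x. x \<in> V \<Longrightarrow> b x = of_nat (c x)"
  shows "eval_mpol (case_gvar b (\<lambda>_. of_nat (max_degree V E + 2)))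
    (total_poly V E v :: ('a gvar, 'p mod_ring) mpol) \<noteq> 0"
proof -
  have inV: "v i \<in> V" if "i \<in> {1..card V}" for i
    using v that by (auto simp: bij_betw_def)
  have b_vertices: "b x \<noteq> b w" if "x \<in> V" "w \<in> nbhd E x" for x w
  proof
    assume "b x = b w"
    have "w \<in> V"
      using that nbhd_subset by blast
    then have "c x = c w"
      using of_nat_mod_ring_inj[where 'p = 'p, of "c x" "c w"] \<open>b x = b w\<close>
        b[of x] b[of w] c(1)[of x] c(1)[of w] p that by simp
    then show False
      using c(2) that by blast
  qed
  \<comment> \<open>The case \<open>l = CARD('p)\<close> says that no colour is 0 in the
    field.\<close>
  have b_large: "b x \<noteq> of_nat l" if "x \<in> V" "max_degree V E + 2 \<le> l" "l \<le> CARD('p)" for x l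
    using of_nat_mod_ring_inj[where 'p = 'p, of "c x" l] b[of x] c(1)[of x] that by auto
  have "(\<Prod>w\<in>later_nbhd E v i. b (v i) - b w) *
      (\<Prod>f\<in>incident_edges E (v i). b (v i) - of_nat (max_degree V E + 2)) *
      (\<Prod>l = max_degree V E + 2..CARD('p). b (v i) - of_nat l) \<noteq> 0"
    if i: "i \<in> {1..card V}" for i
  proof (intro no_zero_divisors)
    show "(\<Prod>w\<in>later_nbhd E v i. b (v i) - b w) \<noteq> 0"
      using b_vertices[OF inV[OF i]] finite_nbhd by (auto simp: later_nbhd_def)
    \<comment> \<open>The common edge value is the smallest \<open>l\<close> covered by
      \<open>b_large\<close>.\<close>
    show "(\<Prod>f\<in>incident_edges E (v i). b (v i) - of_nat (max_degree V E + 2)) \<noteq> 0"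
      using b_large[OF inV[OF i] order_refl p] by simp
    show "(\<Prod>l = max_degree V E + 2..CARD('p). b (v i) - of_nat l) \<noteq> 0"
      using b_large[OF inV[OF i]] by auto
  qed
  then show ?thesis
    unfolding total_poly_def eval_mpol_prod eval_mpol_mult eval_mpol_diff eval_mpol_Var
      eval_mpol_of_nat gvar.case
    by (subst prod_zero_iff) auto
qed

end

theorem theorem4:
  fixes V :: "'a set" and E :: "'a set set" and v :: "nat \<Rightarrow> 'a"
    and n m \<Delta> :: nat
    and P' :: "('a gvar, 'p::prime_card mod_ring) mpol"
  assumes "simple_graph V E"
    and "n = card V" and "m = card E" and "\<Delta> = max_degree V E"
    and "bij_betw v {1..n} V"
    and "CARD('p) \<ge> m\<^sup>2 * (2 * \<Delta> + 2)"
    and "\<not> (m = 0 \<and> CARD('p) = 2)"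
    and "P' = reduction (total_poly V E v)"
  shows "\<exists>(\<alpha> :: 'p mod_ring) (\<beta>e :: 'a set \<Rightarrow> 'p mod_ring).
           \<alpha> \<notin> of_nat ` {0..\<Delta> + 1} \<and>
           (\<forall>f\<in>E. \<beta>e f \<in> insert \<alpha> (of_nat ` {1..\<Delta> + 1})) \<and>
           (\<exists>l :: nat \<Rightarrow> nat.
              eval_mpol \<beta>e (vertex_coeff P' (\<Sum>j = 1..n. Poly_Mapping.single (v j) (l j))) \<noteq> 0) \<and>
           (\<exists>\<beta>v :: 'a \<Rightarrow> 'p mod_ring.
              (\<forall>x\<in>V. \<beta>v x \<in> of_nat ` {1..\<Delta> + 1}) \<and>
              eval_mpol (case_gvar \<beta>v \<beta>e) P' \<noteq> 0)"
proof -
  let ?\<alpha> = "of_nat (\<Delta> + 2) :: 'p mod_ring"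
  note graph = assms(1)
  have p: "\<Delta> + 2 < CARD('p)"
    using max_degree_less_prime[OF graph] assms prime_card[where 'a = 'p] by simp
  obtain c :: "'a \<Rightarrow> nat" where c: "\<And>x. x \<in> V \<Longrightarrow> c x \<in> {1..\<Delta> + 1}"
      "\<And>x y. x \<in> V \<Longrightarrow> y \<in> nbhd E x \<Longrightarrow> c x \<noteq> c y"
    using greedy_colouring[OF graph subset_refl] nbhd_subset[OF graph] assms(4) by blast
  define b :: "'a \<Rightarrow> 'p mod_ring" where "b x = (if x \<in> V then of_nat (c x) else 0)" for x
  have ev: "eval_mpol (case_gvar b (\<lambda>_. ?\<alpha>)) P' \<noteq> 0"
    using eval_total_poly_nonzero[OF graph, of v c b] assms p c
    by (simp add: eval_mpol_reduction b_def)
  obtain l where l: "Poly_Mapping.keys l \<subseteq> V"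
      "eval_mpol (\<lambda>_. ?\<alpha>) (vertex_coeff P' l) \<noteq> 0"
    using nonzero_vertex_coeff[OF ev, of V] by (auto simp: b_def)
  have \<alpha>: "?\<alpha> \<notin> of_nat ` {0..\<Delta> + 1}"
  proof
    assume "?\<alpha> \<in> of_nat ` {0..\<Delta> + 1}"
    then obtain x where x: "?\<alpha> = of_nat x" "x \<le> \<Delta> + 1"
      by auto
    show False
    \<comment> \<open>\<open>of_nat_mod_ring_inj\<close> needs positive numbers, so 0 is treated
      separately, using that \<Delta> + 2 is strictly below \<open>CARD('p)\<close>.\<close>
    proof (cases "x = 0")
      case True
      then have "CARD('p) dvd \<Delta> + 2"
        using x(1) by (intro of_nat_0_mod_ring_dvd) simp
      then show ?thesis
        using p by (auto dest: dvd_imp_le)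
    next
      case False
      then show ?thesis
        using of_nat_mod_ring_inj[OF x(1)] x(2) p by simp
    qed
  qed
  show ?thesis
  proof (intro exI conjI ballI)
    show "?\<alpha> \<notin> of_nat ` {0..\<Delta> + 1}"
      by (rule \<alpha>)
    show "?\<alpha> \<in> insert ?\<alpha> (of_nat ` {1..\<Delta> + 1})"
      by simp
    \<comment> \<open>The exponents asked for are those of the vector \<open>l\<close>, read along
      \<open>v\<close>.\<close>
    show "eval_mpol (\<lambda>_. ?\<alpha>)
        (vertex_coeff P' (\<Sum>j = 1..n. Poly_Mapping.single (v j) (Poly_Mapping.lookup l (v j)))) \<noteq> 0"
      using l(2) unfolding sum_single_reindex[OF assms(5) finite_atLeastAtMost l(1)] .
    show "b x \<in> of_nat ` {1..\<Delta> + 1}" if "x \<in> V" for x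
      using c(1)[OF that] that by (simp add: b_def)
    show "eval_mpol (case_gvar b (\<lambda>_. ?\<alpha>)) P' \<noteq> 0"
      by (rule ev)
  qed
qed

end
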